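(* Let $(V,T,Q,B,S)$ be any feasible solution of the Dynamic Bowser Routing Problem MILP described in the context, that is, any assignment of values to its decision variables satisfying constraints (C1)–(C13). Then for every $t=1,\ldots,T$ and every $a=1,\ldots,A$, $$\sum_{k=1}^t\sum_{i=1}^N V^i_{k}\,l^a_{k,i} \;\geq\; \frac{\sum_{k=1}^t f^a_k - s_a - \sum_{k=1}^t S_k^a}{\min(c_a, c_b)}.$$
   Context: Dynamic Bowser Routing Problem (DBRP) MILP. A single bowser (fuel truck) refuels $A$ assets over $T$ discrete time periods on a site network with $N$ nodes; node $1$ hosts the fuel cistern. Parameters (all given): positive integers $T,A,N$; $\delta_{i,j}\in\{0,1\}$ for $i,j=1,\ldots,N$ ($\delta_{i,j}=1$ iff one can travel from node $i$ to node $j$ in one period); $l^a_{t,i}\in\{0,1\}$, equal to $1$ iff asset $a$ is at node $i$ during period $t$, so that each asset is at exactly one node in each period ($\sum_{i=1}^N l^a_{t,i}=1$ for all $a,t$); fuel consumption $f^a_t\ge 0$ of asset $a$ in period $t$; tank capacity $c_a>0$ and initial tank level $s_a\ge 0$ of asset $a$; bowser tank capacity $c_b>0$ and initial bowser tank level $s_b\ge 0$. Decision variables: $V^i_t$ (bowser at node $i$ at time $t$), $T^{i,j}_t$ (bowser transits from $i$ to $j$ at the end of period $t$; not to be confused with the number of periods $T$), $Q^a_t$ (fuel delivered to asset $a$ at time $t$), $B_t$ (fuel transferred from the cistern to the bowser at time $t$), $S^a_t$ (fuel shortage of asset $a$ at time $t$). Constraints (indices range over $t=1,\ldots,T$, $a=1,\ldots,A$,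 $i,j=1,\ldots,N$, with $t=2,\ldots,T$ in (C5)–(C9)): - (C1) $B_t \leq V^1_t c_b$; - (C2) $s_b + \sum_{k=1}^t B_k - \sum_{k=1}^{t-1} \sum_{a=1}^A Q^a_k \leq c_b$; - (C3) $s_b + \sum_{k=1}^t B_k - \sum_{k=1}^t \sum_{a=1}^A Q^a_k \geq 0$; - (C4) $\sum_{i=1}^N V^i_t = 1$; - (C5) $\delta_{i,j}\geq V^i_{t-1} + V^j_t -1$; - (C6) $\sum_{j=1}^N T_{t-1}^{i,j} = V^i_{t-1}$; - (C7) $T_{t-1}^{i,j}\geq V^i_{t-1}+V^j_{t}-1$; - (C8) $T_{t-1}^{i,j}\leq V^i_{t-1}$; - (C9) $T_{t-1}^{i,j}\leq V^j_{t}$; - (C10) $s_a+\sum_{k=1}^t Q^a_k+\sum_{k=1}^{t-1}S_k^a-\sum_{k=1}^t f^a_k\geq - S_t^a$; - (C11) $s_a+\sum_{k=1}^t Q^a_k+\sum_{k=1}^{t-1}S_k^a-\sum_{k=1}^{t-1} f^a_k\leq c_a$; - (C12) $Q^a_t\leq c_a\sum_{i=1}^N V^i_{t}\,l^a_{t,i}$; - (C13) $T_t^{i,j},V^i_t\in\{0,1\}$, $Q^a_t,B_t\geq 0$, $0\leq S^a_t\leq f^a_t$. *)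

theory Defs
  imports Complex_Main
begin

(* Periods, assets and nodes are numbered from 1 (node 1 hosts the cistern); the values of the
   index functions outside these ranges are never constrained. *)

record dbrp_data =
  periods :: nat
  assets :: nat
  nodes :: nat
  adj :: "nat \<Rightarrow> nat \<Rightarrow> real"  (* delta_{i,j} *)
  loc :: "nat \<Rightarrow> nat \<Rightarrow> nat \<Rightarrow> real"  (* l^a_{t,i}, arguments a t i *)
  fuel_use :: "nat \<Rightarrow> nat \<Rightarrow> real"  (* f^a_t, arguments a t *)
  asset_cap :: "nat \<Rightarrow> real"  (* c_a *)
  asset_init :: "nat \<Rightarrow> real"  (* s_a *)
  bowser_cap :: real  (* c_b *)
  bowser_init :: real  (* s_b *)

definition dbrp_instance :: "dbrp_data \<Rightarrow> bool" where
  "dbrp_instance P \<longleftrightarrow>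
     0 < periods P \<and> 0 < assets P \<and> 0 < nodes P \<and>
     (\<forall>i\<in>{1..nodes P}. \<forall>j\<in>{1..nodes P}. adj P i j \<in> {0, 1}) \<and>
     (\<forall>a\<in>{1..assets P}. \<forall>t\<in>{1..periods P}. \<forall>i\<in>{1..nodes P}. loc P a t i \<in> {0, 1}) \<and>
     (\<forall>a\<in>{1..assets P}. \<forall>t\<in>{1..periods P}. (\<Sum>i=1..nodes P. loc P a t i) = 1) \<and>
     (\<forall>a\<in>{1..assets P}. \<forall>t\<in>{1..periods P}. 0 \<le> fuel_use P a t) \<and>
     (\<forall>a\<in>{1..assets P}. 0 < asset_cap P a \<and> 0 \<le> asset_init P a) \<and>
     0 < bowser_cap P \<and> 0 \<le> bowser_init P"

record dbrp_vars =
  at_node :: "nat \<Rightarrow> nat \<Rightarrow> real"  (* V^i_t, arguments i t *)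
  transit :: "nat \<Rightarrow> nat \<Rightarrow> nat \<Rightarrow> real"  (* T^{i,j}_t, arguments i j t *)
  delivered :: "nat \<Rightarrow> nat \<Rightarrow> real"  (* Q^a_t, arguments a t *)
  loaded :: "nat \<Rightarrow> real"  (* B_t *)
  shortage :: "nat \<Rightarrow> nat \<Rightarrow> real"  (* S^a_t, arguments a t *)

(* Sums over k = 1..t-1 are written with the half-open range {1..<t}. *)

definition dbrp_feasible :: "dbrp_data \<Rightarrow> dbrp_vars \<Rightarrow> bool" where
  "dbrp_feasible P X \<longleftrightarrow>
    (let T = {1..periods P}; T2 = {2..periods P}; A = {1..assets P}; N = {1..nodes P};
         \<delta> = adj P; l = loc P; f = fuel_use P; c = asset_cap P; s = asset_init P;
         cb = bowser_cap P; sb = bowser_init P;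
         V = at_node X; Tr = transit X; Q = delivered X; B = loaded X; S = shortage X
     in
      (\<forall>t\<in>T. B t \<le> V 1 t * cb) \<and>
      (\<forall>t\<in>T. sb + (\<Sum>k=1..t. B k) - (\<Sum>k=1..<t. \<Sum>a\<in>A. Q a k) \<le> cb) \<and>
      (\<forall>t\<in>T. sb + (\<Sum>k=1..t. B k) - (\<Sum>k=1..t. \<Sum>a\<in>A. Q a k) \<ge> 0) \<and>
      (\<forall>t\<in>T. (\<Sum>i\<in>N. V i t) = 1) \<and>
      (\<forall>t\<in>T2. \<forall>i\<in>N. \<forall>j\<in>N. \<delta> i j \<ge> V i (t - 1) + V j t - 1) \<and>
      (\<forall>t\<in>T2. \<forall>i\<in>N. (\<Sum>j\<in>N. Tr i j (t - 1)) = V i (t - 1)) \<and>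
      (\<forall>t\<in>T2. \<forall>i\<in>N. \<forall>j\<in>N. Tr i j (t - 1) \<ge> V i (t - 1) + V j t - 1) \<and>
      (\<forall>t\<in>T2. \<forall>i\<in>N. \<forall>j\<in>N. Tr i j (t - 1) \<le> V i (t - 1)) \<and>
      (\<forall>t\<in>T2. \<forall>i\<in>N. \<forall>j\<in>N. Tr i j (t - 1) \<le> V j t) \<and>
      (\<forall>t\<in>T. \<forall>a\<in>A. s a + (\<Sum>k=1..t. Q a k) + (\<Sum>k=1..<t. S a k) - (\<Sum>k=1..t. f a k) \<ge> - S a t) \<and>
      (\<forall>t\<in>T. \<forall>a\<in>A. s a + (\<Sum>k=1..t. Q a k) + (\<Sum>k=1..<t. S a k) - (\<Sum>k=1..<t. f a k) \<le> c a) \<and>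
      (\<forall>t\<in>T. \<forall>a\<in>A. Q a t \<le> c a * (\<Sum>i\<in>N. V i t * l a t i)) \<and>
      (\<forall>t\<in>T. \<forall>i\<in>N. \<forall>j\<in>N. Tr i j t \<in> {0, 1}) \<and>
      (\<forall>t\<in>T. \<forall>i\<in>N. V i t \<in> {0, 1}) \<and>
      (\<forall>t\<in>T. \<forall>a\<in>A. 0 \<le> Q a t) \<and>
      (\<forall>t\<in>T. 0 \<le> B t) \<and>
      (\<forall>t\<in>T. \<forall>a\<in>A. 0 \<le> S a t \<and> S a t \<le> f a t))"

end

theory Submission
  imports Defs
begin

text \<open>By (C2) and (C3) the deliveries of a single period total at most \<open>c\<^sub>b\<close>, and by (C12) a delivery
  to \<open>a\<close> is at most \<open>c\<^sub>a\<close> and requires the bowser to be at the node of \<open>a\<close>. Hence each visit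
  supplies at most \<open>min c\<^sub>a c\<^sub>b\<close>, while (C10) bounds the total supply from below.\<close>

text \<open>A nonzero product of 0/1 values is 1, and the remaining terms are nonnegative. Applied
  to visit counts, this excludes values strictly between 0 and 1.\<close>

lemma sum_prod_01_cases:
  fixes x y :: "'i \<Rightarrow> 'a::linordered_idom"
  assumes "finite I" "\<And>i. i \<in> I \<Longrightarrow> x i \<in> {0, 1}" "\<And>i. i \<in> I \<Longrightarrow> y i \<in> {0, 1}"
  shows "(\<Sum>i\<in>I. x i * y i) = 0 \<or> 1 \<le> (\<Sum>i\<in>I. x i * y i)"
proof (cases "\<forall>i\<in>I. x i * y i = 0")
  case False
  then obtain j where j: "j \<in> I" "x j * y j \<noteq> 0" by blast
  with assms(2,3)[of j] have "1 = x j * y j" by auto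
  also have "\<dots> \<le> (\<Sum>i\<in>I. x i * y i)"
    using j(1) assms by (intro member_le_sum) (fastforce intro: mult_nonneg_nonneg)+
  finally show ?thesis ..
next
  case True
  then show ?thesis by (intro disjI1 sum.neutral)
qed

lemma delivered_le_bowser_cap:
  assumes "dbrp_feasible P X" "k \<in> {1..periods P}" "a \<in> {1..assets P}"
  shows "delivered X a k \<le> bowser_cap P"
proof -
  have "bowser_init P + (\<Sum>j=1..k. loaded X j)
      - (\<Sum>j=1..<k. \<Sum>b=1..assets P. delivered X b j) \<le> bowser_cap P"
    and "0 \<le> bowser_init P + (\<Sum>j=1..k. loaded X j)
      - (\<Sum>j=1..k. \<Sum>b=1..assets P. delivered X b j)"
    and nonneg: "\<forall>b\<in>{1..assets P}. 0 \<le> delivered X b k"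
    using assms(1,2) unfolding dbrp_feasible_def Let_def by (elim conjE; simp)+
  \<comment> \<open>(C2) subtracts deliveries only before \<open>k\<close>, (C3) also those of
    \<open>k\<close>. In their difference the initial level and all loads cancel, leaving the
    deliveries of period \<open>k\<close>.\<close>
  moreover have "{1..k} = insert k {1..<k}"
    using assms(2) by auto
  ultimately have "(\<Sum>b=1..assets P. delivered X b k) \<le> bowser_cap P"
    by simp
  moreover have "delivered X a k \<le> (\<Sum>b=1..assets P. delivered X b k)"
    using nonneg assms(3) by (intro member_le_sum) auto
  ultimately show ?thesis by linarith
qed

lemma delivered_le_visits:
  assumes "dbrp_instance P" "dbrp_feasible P X" "k \<in> {1..periods P}" "a \<in> {1..assets P}"
  shows "delivered X a k
    \<le> min (asset_cap P a) (bowser_cap P) * (\<Sum>i=1..nodes P. at_node X i k * loc P a k i)"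
    (is "_ \<le> ?m * ?v")
proof -
  have V: "\<forall>i\<in>{1..nodes P}. at_node X i k \<in> {0, 1}"
    and Q: "delivered X a k \<le> asset_cap P a * ?v"
    using assms(2-4) unfolding dbrp_feasible_def Let_def by (elim conjE; simp)+
  have l: "\<forall>i\<in>{1..nodes P}. loc P a k i \<in> {0, 1}" and cb: "0 < bowser_cap P"
    using assms(1,3,4) unfolding dbrp_instance_def by blast+
  \<comment> \<open>The bound by \<open>bowser_cap P\<close> lacks the factor \<open>?v\<close>. If
    \<open>?v = 0\<close>, (C12) already forces the delivery to be at most 0; if
    \<open>1 \<le> ?v\<close>, the factor only weakens the bound.\<close>
  have "?v = 0 \<or> 1 \<le> ?v"
    by (rule sum_prod_01_cases) (use V l in auto)
  then show ?thesis
  proof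
    assume "?v = 0"
    with Q show ?thesis by simp
  next
    assume v: "1 \<le> ?v"
    have "delivered X a k \<le> bowser_cap P * ?v"
      using delivered_le_bowser_cap[OF assms(2-4)] mult_left_mono[OF v, of "bowser_cap P"] cb
      by linarith
    with Q show ?thesis by (simp add: min_def)
  qed
qed

theorem lemma1:
  fixes P :: dbrp_data and X :: dbrp_vars and t a :: nat
  assumes "dbrp_instance P"
    and "dbrp_feasible P X"
    and "t \<in> {1..periods P}"
    and "a \<in> {1..assets P}"
  shows "(\<Sum>k=1..t. \<Sum>i=1..nodes P. at_node X i k * loc P a k i)
    \<ge> ((\<Sum>k=1..t. fuel_use P a k) - asset_init P a - (\<Sum>k=1..t. shortage X a k))
        / min (asset_cap P a) (bowser_cap P)"
proof -
  let ?m = "min (asset_cap P a) (bowser_cap P)"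
  let ?v = "\<lambda>k. \<Sum>i=1..nodes P. at_node X i k * loc P a k i"
  have "asset_init P a + (\<Sum>k=1..t. delivered X a k) + (\<Sum>k=1..<t. shortage X a k)
      - (\<Sum>k=1..t. fuel_use P a k) \<ge> - shortage X a t"
    using assms(2-4) unfolding dbrp_feasible_def Let_def by (elim conjE) simp
  \<comment> \<open>(C10) keeps the shortage of period \<open>t\<close> apart on its right-hand
    side; joining it to the earlier ones gives the full sum.\<close>
  moreover have "(\<Sum>k=1..t. shortage X a k) = (\<Sum>k=1..<t. shortage X a k) + shortage X a t"
    using assms(3) by (simp add: sum.last_plus)
  ultimately have "(\<Sum>k=1..t. fuel_use P a k) - asset_init P a - (\<Sum>k=1..t. shortage X a k)
      \<le> (\<Sum>k=1..t. delivered X a k)"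
    by linarith
  also have "\<dots> \<le> (\<Sum>k=1..t. ?m * ?v k)"
    using assms by (intro sum_mono delivered_le_visits) auto
  also have "\<dots> = (\<Sum>k=1..t. ?v k) * ?m"
    by (simp add: sum_distrib_left mult.commute)
  finally show ?thesis
    \<comment> \<open>Both capacities are positive, hence so is the divisor
      \<open>?m\<close>.\<close>
    using assms(1,4) by (subst pos_divide_le_eq) (auto simp: dbrp_instance_def)
qed

end
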